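(* Let $X$ be a compact metric space. If there exists a distal homeomorphism $f:X\to X$ with the almost POTP, then $X$ is almost totally disconnected.
   Context: Let $f:X\to X$ be a homeomorphism of a metric space $(X,d)$. For $\delta>0$, a bi-infinite sequence $\xi=(\xi_n)_{n\in\mathbb{Z}}$ of points of $X$ is a $\delta$-pseudo-orbit if $d(f(\xi_n),\xi_{n+1})\leq\delta$ for all $n\in\mathbb{Z}$. For $\epsilon>0$, $\xi$ can be $\epsilon$-shadowed if there is $x\in X$ such that $d(f^n(x),\xi_n)\leq\epsilon$ for all $n\in\mathbb{Z}$. A point $x\in X$ is shadowable if for every $\epsilon>0$ there is $\delta>0$ such that every $\delta$-pseudo-orbit $\xi$ with $\xi_0=x$ can be $\epsilon$-shadowed. $Sh(f)$ denotes the set of shadowable points of $f$, and $f$ has the almost POTP if $Sh(f)$ is dense in $X$. The homeomorphism $f$ is distal if $\inf_{n\in\mathbb{Z}}d(f^n(x),f^n(y))>0$ for all distinct points $x,y\in X$. $X$ is totally disconnected at $p\in X$ if the connected component of $X$ containing $p$ is $\{p\}$; $X^{deg}=\{p\in X: X\text{ is totally disconnected at }p\}$; and $X$ is almost totally disconnected if $X^{deg}$ is dense in $X$. *)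

theory Defs
  imports "HOL-Analysis.Analysis"
begin

text \<open>The space is a subset \<open>X\<close> of a metric type with the restricted metric; the values of
  \<open>f\<close> outside \<open>X\<close> are irrelevant.\<close>

definition self_homeomorphism :: "'a::topological_space set \<Rightarrow> ('a \<Rightarrow> 'a) \<Rightarrow> bool" where
  "self_homeomorphism X f \<longleftrightarrow> (\<exists>g. homeomorphism X X f g)"

text \<open>The integer power \<open>f\<^sup>n\<close> on \<open>X\<close>, meaningful at points of \<open>X\<close> when \<open>f\<close> is a bijection
  of \<open>X\<close>; the inverse is taken relative to \<open>X\<close>.\<close>

definition iter :: "'a set \<Rightarrow> ('a \<Rightarrow> 'a) \<Rightarrow> int \<Rightarrow> 'a \<Rightarrow> 'a" where
  "iter X f n = (if 0 \<le> n then f ^^ nat n else inv_into X f ^^ nat (- n))"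

definition pseudo_orbit ::
    "'a::metric_space set \<Rightarrow> ('a \<Rightarrow> 'a) \<Rightarrow> real \<Rightarrow> (int \<Rightarrow> 'a) \<Rightarrow> bool" where
  "pseudo_orbit X f \<delta> \<xi> \<longleftrightarrow>
     (\<forall>n. \<xi> n \<in> X) \<and> (\<forall>n. dist (f (\<xi> n)) (\<xi> (n + 1)) \<le> \<delta>)"

definition can_be_shadowed ::
    "'a::metric_space set \<Rightarrow> ('a \<Rightarrow> 'a) \<Rightarrow> real \<Rightarrow> (int \<Rightarrow> 'a) \<Rightarrow> bool" where
  "can_be_shadowed X f \<epsilon> \<xi> \<longleftrightarrow> (\<exists>x\<in>X. \<forall>n. dist (iter X f n x) (\<xi> n) \<le> \<epsilon>)"

definition shadowable_point :: "'a::metric_space set \<Rightarrow> ('a \<Rightarrow> 'a) \<Rightarrow> 'a \<Rightarrow> bool" where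
  "shadowable_point X f x \<longleftrightarrow> x \<in> X \<and>
     (\<forall>\<epsilon>>0. \<exists>\<delta>>0. \<forall>\<xi>. pseudo_orbit X f \<delta> \<xi> \<and> \<xi> 0 = x \<longrightarrow> can_be_shadowed X f \<epsilon> \<xi>)"

definition Sh :: "'a::metric_space set \<Rightarrow> ('a \<Rightarrow> 'a) \<Rightarrow> 'a set" where
  "Sh X f = {x. shadowable_point X f x}"

definition almost_POTP :: "'a::metric_space set \<Rightarrow> ('a \<Rightarrow> 'a) \<Rightarrow> bool" where
  "almost_POTP X f \<longleftrightarrow> X \<subseteq> closure (Sh X f)"

definition distal :: "'a::metric_space set \<Rightarrow> ('a \<Rightarrow> 'a) \<Rightarrow> bool" where
  "distal X f \<longleftrightarrow>
     (\<forall>x\<in>X. \<forall>y\<in>X. x \<noteq> y \<longrightarrow> (INF n::int. dist (iter X f n x) (iter X f n y)) > 0)"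

definition totally_disconnected_at :: "'a::topological_space set \<Rightarrow> 'a \<Rightarrow> bool" where
  "totally_disconnected_at X p \<longleftrightarrow> connected_component_set X p = {p}"

definition deg :: "'a::topological_space set \<Rightarrow> 'a set" where
  "deg X = {p \<in> X. totally_disconnected_at X p}"

definition almost_totally_disconnected :: "'a::topological_space set \<Rightarrow> bool" where
  "almost_totally_disconnected X \<longleftrightarrow> X \<subseteq> closure (deg X)"

end

theory Submission
  imports Defs
begin

text \<open>Every shadowable point of a distal homeomorphism \<open>f\<close> of a compact space is a point of total
  disconnectedness; the theorem follows by density. The argument has two ingredients.

  \<^item> \<^emph>\<open>Recurrence.\<close> By the Ellis--Numakura lemma, the closure of \<open>{g\<^sup>n | n \<ge> 1}\<close> in \<open>X\<^sup>X\<close> contains an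
  idempotent \<open>u\<close>. As \<open>u\<close> takes the same value at \<open>x\<close> and at \<open>u x\<close>, these two points are proximal, so
  they are equal if \<open>g\<close> is distal; then \<open>x = u x\<close> is a limit of points \<open>g\<^sup>n x\<close>. Powers of a
  distal map are distal, so every point is recurrent under every \<open>f\<^sup>a\<close>
  (\<open>forward_distal_imp_recurrent_power\<close>).

  \<^item> \<^emph>\<open>Travelling inside a connected set.\<close> In a connected set of points that are recurrent under
  \<open>f\<^sup>a\<close>, any point leads to any other by a \<open>\<delta>\<close>-pseudo-orbit whose length is a multiple of \<open>a\<close>: wait
  until the current point returns close to itself, then jump to a nearby point
  (\<open>connected_imp_links\<close>).

  Suppose now that \<open>x\<close> is shadowable and that \<open>y \<noteq> x\<close> lies in the component of \<open>x\<close>. Choose \<open>a\<close> with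
  \<open>f\<^sup>a x\<close> close to \<open>x\<close>. There is a pseudo-orbit that starts at \<open>x\<close>, is at \<open>y\<close> at
  some time \<open>t\<close> divisible by \<open>a\<close>, and eventually repeats \<open>x, f x, \<dots>, f\<^sup>a\<^sup>-\<^sup>1 x\<close> forever, being at \<open>x\<close> at
  all late multiples of \<open>a\<close>. If the orbit of \<open>w\<close> shadows it, then \<open>z = f\<^sup>t w\<close> is close to \<open>y\<close> while
  \<open>f\<^sup>k\<^sup>a z\<close> is close to \<open>x\<close> for all large \<open>k\<close>, so \<open>z\<close> is not recurrent under a high
  power of \<open>f\<^sup>a\<close>.\<close>

section \<open>Idempotents in compact semigroups\<close>

text \<open>Ellis--Numakura. By compactness and Zorn's lemma there is a minimal nonempty closed
  subsemigroup \<open>A\<close>. For \<open>u \<in> A\<close>, the closed subsemigroup \<open>A u\<close> equals \<open>A\<close> by minimality, so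
  \<open>{p \<in> A. p u = u}\<close> is nonempty; it is again a closed subsemigroup, hence equal to \<open>A\<close>, and it
  therefore contains \<open>u\<close>.\<close>

lemma compact_semigroup_has_idempotent:
  fixes T :: "'b topology" and mul :: "'b \<Rightarrow> 'b \<Rightarrow> 'b"
  assumes comp: "compact_space T" and haus: "Hausdorff_space T" and ne: "topspace T \<noteq> {}"
    and mul: "\<And>p q. \<lbrakk>p \<in> topspace T; q \<in> topspace T\<rbrakk> \<Longrightarrow> mul p q \<in> topspace T"
    and assoc: "\<And>p q r. \<lbrakk>p \<in> topspace T; q \<in> topspace T; r \<in> topspace T\<rbrakk>
                  \<Longrightarrow> mul (mul p q) r = mul p (mul q r)"
    and cont: "\<And>q. q \<in> topspace T \<Longrightarrow> continuous_map T T (\<lambda>p. mul p q)"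
  shows "\<exists>u\<in>topspace T. mul u u = u"
proof -
  define S where "S = {A. closedin T A \<and> A \<noteq> {} \<and> (\<forall>p\<in>A. \<forall>q\<in>A. mul p q \<in> A)}"
  have top: "topspace T \<in> S"
    using ne mul by (simp add: S_def)
  have "\<exists>A\<in>S. \<forall>B\<in>S. A \<supseteq> B \<longrightarrow> B = A"
  proof (rule predicate_Zorn)
    show "partial_order_on S (relation_of (\<lambda>A B. A \<supseteq> B) S)"
      by (rule partial_order_on_relation_ofI) auto
  next
    fix C assume "C \<in> Chains (relation_of (\<lambda>A B. A \<supseteq> B) S)"
    then have CS: "C \<subseteq> S" and lin: "\<And>A B. \<lbrakk>A \<in> C; B \<in> C\<rbrakk> \<Longrightarrow> A \<subseteq> B \<or> B \<subseteq> A"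
      by (auto simp: Chains_def relation_of_def)
    show "\<exists>L\<in>S. \<forall>A\<in>C. A \<supseteq> L"
    proof (cases "C = {}")
      case True
      then show ?thesis using top by blast
    next
      case False
      have fip: "\<Inter>F \<noteq> {}" if "finite F" "F \<subseteq> C" for F
      proof (cases "F = {}")
        case False
        then obtain M where M: "M \<in> F" "\<forall>A\<in>F. A \<subseteq> M \<longrightarrow> M = A"
          using finite_has_minimal[OF \<open>finite F\<close>] by blast
        have "M \<subseteq> A" if "A \<in> F" for A
          using M that lin[of A M] \<open>F \<subseteq> C\<close> by blast
        then have "M \<subseteq> \<Inter>F"
          by blast
        moreover have "M \<noteq> {}"
          using M(1) that CS by (auto simp: S_def)
        ultimately show ?thesis by blast
      qed simp
      have "closedin T A" if "A \<in> C" for A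
        using CS that by (auto simp: S_def)
      then have "\<Inter>C \<noteq> {}"
        using comp[unfolded compact_space_fip, rule_format, of C] fip by auto
      moreover have "closedin T (\<Inter>C)"
        using False CS by (intro closedin_Inter) (auto simp: S_def)
      moreover have "mul p q \<in> \<Inter>C" if "p \<in> \<Inter>C" "q \<in> \<Inter>C" for p q
        using that CS by (auto simp: S_def)
      ultimately have "\<Inter>C \<in> S"
        by (simp add: S_def)
      then show ?thesis by blast
    qed
  qed
  then obtain A where A: "A \<in> S" and min: "\<And>B. \<lbrakk>B \<in> S; B \<subseteq> A\<rbrakk> \<Longrightarrow> B = A"
    by blast
  have clA: "closedin T A" and mulA: "\<And>p q. \<lbrakk>p \<in> A; q \<in> A\<rbrakk> \<Longrightarrow> mul p q \<in> A"
    using A by (auto simp: S_def)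
  have subA: "p \<in> topspace T" if "p \<in> A" for p
    using closedin_subset[OF clA] that by blast
  obtain u where u: "u \<in> A"
    using A by (auto simp: S_def)
  have "(\<lambda>p. mul p u) ` A = A"
  proof (rule min)
    have "compactin T ((\<lambda>p. mul p u) ` A)"
      using closedin_compact_space[OF comp clA] cont[OF subA[OF u]] by (rule image_compactin)
    then have "closedin T ((\<lambda>p. mul p u) ` A)"
      by (rule compactin_imp_closedin[OF haus])
    moreover have "mul (mul p u) (mul q u) \<in> (\<lambda>p. mul p u) ` A" if "p \<in> A" "q \<in> A" for p q
    proof -
      have "mul (mul p u) (mul q u) = mul (mul (mul p u) q) u"
        using that u by (simp add: assoc subA mulA)
      then show ?thesis
        using that u mulA by blast
    qed
    ultimately show "(\<lambda>p. mul p u) ` A \<in> S"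
      using u by (auto simp: S_def)
  qed (use u mulA in auto)
  then obtain p where p: "p \<in> A" "mul p u = u"
    using u by (metis imageE)
  define B where "B = {p \<in> A. mul p u = u}"
  have "B = A"
  proof (rule min)
    have "closedin T {p \<in> topspace T. mul p u \<in> {u}}"
      using closedin_continuous_map_preimage[OF cont[OF subA[OF u]]]
        closedin_Hausdorff_singleton[OF haus subA[OF u]] by blast
    moreover have "B = A \<inter> {p \<in> topspace T. mul p u \<in> {u}}"
      using subA by (auto simp: B_def)
    ultimately have "closedin T B"
      using clA by (simp add: closedin_Int)
    moreover have "mul p q \<in> B" if "p \<in> B" "q \<in> B" for p q
      using that u by (simp add: B_def mulA assoc subA)
    ultimately show "B \<in> S"
      using p by (auto simp: S_def B_def)
  qed (auto simp: B_def)
  then show ?thesis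
    using u subA by (auto simp: B_def)
qed

section \<open>Recurrence of distal maps\<close>

lemma funpow_in:
  assumes "f ` X \<subseteq> X" "x \<in> X"
  shows "(f ^^ n) x \<in> X"
  using assms by (induction n) auto

lemma continuous_on_funpow:
  assumes "continuous_on X f" "f ` X \<subseteq> X"
  shows "continuous_on X (f ^^ n)"
proof (induction n)
  case (Suc n)
  have "continuous_on ((f ^^ n) ` X) f"
    using assms funpow_in[OF assms(2)] by (meson continuous_on_subset image_subsetI)
  then show ?case
    using continuous_on_compose[OF Suc] by simp
qed (simp add: id_def)

text \<open>The recurrence argument compares forward iterates only. Separation of these, unlike an infimum
  over all integer times, passes to the powers \<open>f\<^sup>a\<close> without any computation of inverses.\<close>

definition forward_distal :: "'a::metric_space set \<Rightarrow> ('a \<Rightarrow> 'a) \<Rightarrow> bool" where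
  "forward_distal X g \<longleftrightarrow>
     (\<forall>x\<in>X. \<forall>y\<in>X. x \<noteq> y \<longrightarrow> (\<exists>c>0. \<forall>n. c \<le> dist ((g ^^ n) x) ((g ^^ n) y)))"

lemma distal_imp_forward_distal:
  assumes "distal X f"
  shows "forward_distal X f"
  unfolding forward_distal_def
proof (intro ballI impI)
  fix x y assume xy: "x \<in> X" "y \<in> X" "x \<noteq> y"
  let ?d = "\<lambda>n::int. dist (iter X f n x) (iter X f n y)"
  have "(INF n. ?d n) > 0"
    using assms xy unfolding distal_def by blast
  moreover have "(INF n. ?d n) \<le> dist ((f ^^ n) x) ((f ^^ n) y)" for n
  proof -
    have "bdd_below (range ?d)"
      by (rule bdd_belowI[of _ 0]) auto
    then have "(INF n. ?d n) \<le> ?d (int n)"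
      by (rule cINF_lower) simp
    then show ?thesis
      by (simp add: iter_def)
  qed
  ultimately show "\<exists>c>0. \<forall>n. c \<le> dist ((f ^^ n) x) ((f ^^ n) y)"
    by blast
qed

lemma forward_distal_funpow:
  assumes "forward_distal X f"
  shows "forward_distal X (f ^^ a)"
  using assms unfolding forward_distal_def by (metis funpow_mult)

text \<open>The enveloping semigroup is the closure of the powers of \<open>g\<close> in the product \<open>X\<^sup>X\<close>. Only the
  right translations \<open>p \<mapsto> p \<circ> q\<close> are continuous on it in general, but left translation by a power
  of \<open>g\<close> is continuous too, and this is what makes the closure a semigroup.\<close>

lemma powers_accumulate_at_idempotent:
  fixes X :: "'a::metric_space set"
  assumes "compact X" and cont: "continuous_on X g" and gX: "g ` X \<subseteq> X"
  shows "\<exists>u. (\<forall>x\<in>X. u x \<in> X \<and> u (u x) = u x) \<and>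
    (\<forall>x\<in>X. \<forall>y\<in>X. \<forall>e>0. \<exists>n\<ge>1. dist ((g ^^ n) x) (u x) < e \<and> dist ((g ^^ n) y) (u y) < e)"
proof -
  define T where "T = product_topology (\<lambda>_. top_of_set X) X"
  define P where "P = (\<lambda>n. restrict (g ^^ n) X) ` {1..}"
  define E where "E = T closure_of P"
  have topT: "topspace T = X \<rightarrow>\<^sub>E X"
    by (simp add: T_def)
  have "compact_space T"
    using \<open>compact X\<close> by (simp add: T_def compact_space_product_topology compact_space_subtopology)
  have "Hausdorff_space T"
    by (simp add: T_def Hausdorff_space_product_topology Hausdorff_space_subtopology)
  have PT: "P \<subseteq> topspace T"
    using funpow_in[OF gX] by (auto simp: P_def topT)
  have PE: "P \<subseteq> E"
    unfolding E_def using closure_of_subset[OF PT] .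
  have ET: "E \<subseteq> topspace T"
    unfolding E_def by (rule closure_of_subset_topspace)
  have clE: "closedin T E"
    unfolding E_def by simp
  have right: "continuous_map T T (\<lambda>p. compose X p q)" if "q \<in> topspace T" for q
  proof -
    have "continuous_map T (top_of_set X) (\<lambda>p. p (q k))" if "k \<in> X" for k
      unfolding T_def using \<open>q \<in> topspace T\<close> that
      by (intro continuous_map_product_projection) (auto simp: topT)
    then show ?thesis
      unfolding T_def continuous_map_componentwise by (auto simp: compose_def)
  qed
  have left: "continuous_map T T (\<lambda>q. compose X (restrict (g ^^ n) X) q)" for n
  proof -
    have "continuous_map T (top_of_set X) (\<lambda>q. restrict (g ^^ n) X (q k))" if "k \<in> X" for k
    proof -
      have "continuous_map (top_of_set X) (top_of_set X) (restrict (g ^^ n) X)"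
        using continuous_on_funpow[OF cont gX] funpow_in[OF gX]
        by (auto cong: continuous_on_cong)
      moreover have "continuous_map T (top_of_set X) (\<lambda>q. q k)"
        unfolding T_def using that by (rule continuous_map_product_projection)
      ultimately show ?thesis
        using continuous_map_compose[of T "top_of_set X" "\<lambda>q. q k"] unfolding o_def by blast
    qed
    then show ?thesis
      unfolding T_def continuous_map_componentwise by (auto simp: compose_def)
  qed
  have PP: "compose X p q \<in> P" if "p \<in> P" "q \<in> P" for p q
  proof -
    obtain m n where mn: "m \<ge> 1" "n \<ge> 1" "p = restrict (g ^^ m) X" "q = restrict (g ^^ n) X"
      using \<open>p \<in> P\<close> \<open>q \<in> P\<close> by (auto simp: P_def)
    have "compose X p q = restrict (g ^^ (m + n)) X"
      using mn funpow_in[OF gX] by (auto simp: compose_def funpow_add fun_eq_iff restrict_def)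
    moreover have "m + n \<in> {1..}"
      using mn by simp
    ultimately show ?thesis
      unfolding P_def by blast
  qed
  have PEE: "compose X p q \<in> E" if "p \<in> P" "q \<in> E" for p q
  proof -
    obtain n where n: "p = restrict (g ^^ n) X"
      using \<open>p \<in> P\<close> by (auto simp: P_def)
    have "(\<lambda>q. compose X p q) ` E \<subseteq> T closure_of ((\<lambda>q. compose X p q) ` P)"
      unfolding E_def n by (rule continuous_map_image_closure_subset[OF left])
    also have "\<dots> \<subseteq> E"
      unfolding E_def using PP \<open>p \<in> P\<close> by (intro closure_of_mono) blast
    finally show ?thesis using \<open>q \<in> E\<close> by blast
  qed
  have EE: "compose X p q \<in> E" if "p \<in> E" "q \<in> E" for p q
  proof -
    have "(\<lambda>p. compose X p q) ` E \<subseteq> T closure_of ((\<lambda>p. compose X p q) ` P)"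
      using continuous_map_image_closure_subset[OF right] \<open>q \<in> E\<close> ET unfolding E_def by blast
    also have "\<dots> \<subseteq> E"
      using PEE \<open>q \<in> E\<close> clE by (intro closure_of_minimal) auto
    finally show ?thesis using \<open>p \<in> E\<close> by blast
  qed
  have topE: "topspace (subtopology T E) = E"
    using ET by auto
  have "\<exists>u\<in>topspace (subtopology T E). compose X u u = u"
  proof (rule compact_semigroup_has_idempotent[where mul = "compose X"])
    show "compact_space (subtopology T E)"
      using \<open>compact_space T\<close> clE by (simp add: closedin_compact_space compact_space_subtopology)
    show "Hausdorff_space (subtopology T E)"
      using \<open>Hausdorff_space T\<close> by (rule Hausdorff_space_subtopology)
    have "restrict (g ^^ 1) X \<in> P"
      unfolding P_def by blast
    then show "topspace (subtopology T E) \<noteq> {}"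
      using PE topE by blast
    show "compose X p q \<in> topspace (subtopology T E)"
      if "p \<in> topspace (subtopology T E)" "q \<in> topspace (subtopology T E)" for p q
      using that EE unfolding topE by blast
    show "compose X (compose X p q) r = compose X p (compose X q r)"
      if "r \<in> topspace (subtopology T E)" for p q r
    proof -
      have "r \<in> X \<rightarrow> X"
        using that ET unfolding topE topT by (auto simp: PiE_def)
      then show ?thesis
        by (simp add: compose_assoc[of r X X])
    qed
    show "continuous_map (subtopology T E) (subtopology T E) (\<lambda>p. compose X p q)"
      if "q \<in> topspace (subtopology T E)" for q
      using that right[of q] EE ET unfolding topE
      by (auto simp: continuous_map_in_subtopology continuous_map_from_subtopology topE)
  qed
  then obtain u where uE: "u \<in> E" and uu: "compose X u u = u"
    unfolding topE by blast
  have uX: "u x \<in> X" if "x \<in> X" for x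
    using that uE ET by (auto simp: topT)
  have "u (u x) = u x" if "x \<in> X" for x
    using fun_cong[OF uu, of x] that by (simp add: compose_def)
  moreover have "\<exists>n\<ge>1. dist ((g ^^ n) x) (u x) < e \<and> dist ((g ^^ n) y) (u y) < e"
    if "x \<in> X" "y \<in> X" "e > 0" for x y e
  proof -
    define U where "U k = {p \<in> topspace T. p k \<in> X \<inter> ball (u k) e}" for k
    have "openin T (U k)" if "k \<in> X" for k
      unfolding U_def T_def
      by (rule openin_continuous_map_preimage[OF continuous_map_product_projection[OF that]])
        (simp add: openin_open_Int)
    then have "openin T (U x \<inter> U y)"
      using that by blast
    moreover have "u \<in> U x \<inter> U y"
      using that uX uE ET by (auto simp: U_def)
    ultimately obtain p where "p \<in> P" "p \<in> U x \<inter> U y"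
      using uE unfolding E_def in_closure_of by blast
    then show ?thesis
      using that by (auto simp: P_def U_def dist_commute)
  qed
  ultimately show ?thesis
    using uX by blast
qed

text \<open>Along suitable times \<open>n\<close> the points \<open>g\<^sup>n x\<close> and \<open>g\<^sup>n (u x)\<close> both approach \<open>u x = u (u x)\<close>, so
  distality forces \<open>u x = x\<close>.\<close>

lemma forward_distal_imp_recurrent:
  fixes X :: "'a::metric_space set"
  assumes "compact X" "continuous_on X g" "g ` X \<subseteq> X"
    and distal: "forward_distal X g" and x: "x \<in> X" and e: "e > 0"
  shows "\<exists>n\<ge>1. dist ((g ^^ n) x) x < e"
proof -
  obtain u where u: "\<And>x. x \<in> X \<Longrightarrow> u x \<in> X \<and> u (u x) = u x"
    and lim: "\<And>x y e. \<lbrakk>x \<in> X; y \<in> X; e > 0\<rbrakk>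
      \<Longrightarrow> \<exists>n\<ge>1. dist ((g ^^ n) x) (u x) < e \<and> dist ((g ^^ n) y) (u y) < e"
    using powers_accumulate_at_idempotent[OF assms(1-3)] by blast
  have "u x = x"
  proof (rule ccontr)
    assume "u x \<noteq> x"
    then obtain c where c: "c > 0" "\<And>n. c \<le> dist ((g ^^ n) (u x)) ((g ^^ n) x)"
      using distal u[OF x] x unfolding forward_distal_def by blast
    obtain n where "dist ((g ^^ n) x) (u x) < c / 2" "dist ((g ^^ n) (u x)) (u (u x)) < c / 2"
      using lim[of x "u x" "c / 2"] u x c(1) by force
    then have "dist ((g ^^ n) (u x)) ((g ^^ n) x) < c"
      using u[OF x] by (metis dist_triangle_half_l)
    then show False
      using c(2)[of n] by simp
  qed
  then show ?thesis
    using lim[OF x x e] by auto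
qed

lemma forward_distal_imp_recurrent_power:
  fixes X :: "'a::metric_space set"
  assumes "compact X" and cont: "continuous_on X f" and fX: "f ` X \<subseteq> X"
    and distal: "forward_distal X f" and x: "x \<in> X" and e: "e > 0"
  shows "\<exists>n\<ge>1. dist ((f ^^ (a * n)) x) x < e"
proof -
  have "(f ^^ a) ` X \<subseteq> X"
    using funpow_in[OF fX] by blast
  then show ?thesis
    using forward_distal_imp_recurrent[OF \<open>compact X\<close> continuous_on_funpow[OF cont fX]
        _ forward_distal_funpow[OF distal] x e] by (simp add: funpow_mult)
qed

section \<open>Pseudo-orbits inside a connected set\<close>

definition forward_pseudo_orbit ::
    "'a::metric_space set \<Rightarrow> ('a \<Rightarrow> 'a) \<Rightarrow> real \<Rightarrow> (nat \<Rightarrow> 'a) \<Rightarrow> bool" where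
  "forward_pseudo_orbit X f \<delta> \<eta> \<longleftrightarrow>
     (\<forall>n. \<eta> n \<in> X) \<and> (\<forall>n. dist (f (\<eta> n)) (\<eta> (Suc n)) \<le> \<delta>)"

text \<open>This says that some finite \<open>\<delta>\<close>-chain leads from \<open>u\<close> to \<open>v\<close> in a number of steps divisible by
  \<open>a\<close>. The chain is represented by its effect of being put in front of pseudo-orbits that start
  at \<open>v\<close>, so that concatenation of chains becomes composition of implications.\<close>

definition links ::
    "'a::metric_space set \<Rightarrow> ('a \<Rightarrow> 'a) \<Rightarrow> real \<Rightarrow> nat \<Rightarrow> 'a \<Rightarrow> 'a \<Rightarrow> bool" where
  "links X f \<delta> a u v \<longleftrightarrow> (\<exists>m. a dvd m \<and>
     (\<forall>\<eta>. forward_pseudo_orbit X f \<delta> \<eta> \<and> \<eta> 0 = v \<longrightarrow>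
       (\<exists>\<eta>'. forward_pseudo_orbit X f \<delta> \<eta>' \<and> \<eta>' 0 = u \<and> (\<forall>i. \<eta>' (m + i) = \<eta> i))))"

lemma links_trans:
  assumes "links X f \<delta> a u v" "links X f \<delta> a v w"
  shows "links X f \<delta> a u w"
proof -
  obtain m where m: "a dvd m" "\<And>\<eta>. \<lbrakk>forward_pseudo_orbit X f \<delta> \<eta>; \<eta> 0 = v\<rbrakk> \<Longrightarrow>
      \<exists>\<eta>'. forward_pseudo_orbit X f \<delta> \<eta>' \<and> \<eta>' 0 = u \<and> (\<forall>i. \<eta>' (m + i) = \<eta> i)"
    using assms(1) unfolding links_def by blast
  obtain k where k: "a dvd k" "\<And>\<eta>. \<lbrakk>forward_pseudo_orbit X f \<delta> \<eta>; \<eta> 0 = w\<rbrakk> \<Longrightarrow>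
      \<exists>\<eta>'. forward_pseudo_orbit X f \<delta> \<eta>' \<and> \<eta>' 0 = v \<and> (\<forall>i. \<eta>' (k + i) = \<eta> i)"
    using assms(2) unfolding links_def by blast
  have "\<exists>\<eta>'. forward_pseudo_orbit X f \<delta> \<eta>' \<and> \<eta>' 0 = u \<and> (\<forall>i. \<eta>' ((m + k) + i) = \<eta> i)"
    if "forward_pseudo_orbit X f \<delta> \<eta>" "\<eta> 0 = w" for \<eta>
    using k(2)[OF that] m(2) by (metis add.assoc)
  then show ?thesis
    unfolding links_def using m(1) k(1) by (blast intro: dvd_add)
qed

lemma near_return_imp_links:
  assumes fX: "f ` X \<subseteq> X" and u: "u \<in> X" and m: "m \<ge> 1" "a dvd m"
    and close: "dist ((f ^^ m) u) v \<le> \<delta>" and "\<delta> \<ge> 0"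
  shows "links X f \<delta> a u v"
  unfolding links_def
proof (intro exI[of _ m] conjI allI impI)
  fix \<eta> assume \<eta>: "forward_pseudo_orbit X f \<delta> \<eta> \<and> \<eta> 0 = v"
  let ?\<eta>' = "\<lambda>i. if i < m then (f ^^ i) u else \<eta> (i - m)"
  have "dist (f (?\<eta>' n)) (?\<eta>' (Suc n)) \<le> \<delta>" for n
  proof -
    consider "Suc n < m" | "Suc n = m" | "m \<le> n"
      by linarith
    then show ?thesis
    proof cases
      case 2
      then show ?thesis using close \<eta> by auto
    next
      case 3
      then show ?thesis using \<eta> by (simp add: forward_pseudo_orbit_def Suc_diff_le)
    qed (use \<open>\<delta> \<ge> 0\<close> in simp)
  qed
  then have "forward_pseudo_orbit X f \<delta> ?\<eta>'"
    using \<eta> funpow_in[OF fX u] by (simp add: forward_pseudo_orbit_def)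
  then show "\<exists>\<eta>'. forward_pseudo_orbit X f \<delta> \<eta>' \<and> \<eta>' 0 = u \<and> (\<forall>i. \<eta>' (m + i) = \<eta> i)"
    using m by (intro exI[of _ ?\<eta>']) auto
qed (use m in simp)

text \<open>A point can wait for a close return and then jump to any nearby point, so \<open>links\<close> holds between
  all points of a small ball. As \<open>links\<close> is transitive, it then holds throughout a connected set.\<close>

lemma connected_imp_links:
  fixes X :: "'a::metric_space set"
  assumes fX: "f ` X \<subseteq> X" and "\<delta> > 0" and a: "a \<ge> 1"
    and rec: "\<And>p e. \<lbrakk>p \<in> X; e > 0\<rbrakk> \<Longrightarrow> \<exists>n\<ge>1. dist ((f ^^ (a * n)) p) p < e"
    and C: "connected C" "C \<subseteq> X" and uv: "u \<in> C" "v \<in> C"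
  shows "links X f \<delta> a u v"
proof -
  have near: "links X f \<delta> a p q" if "p \<in> X" "dist p q < \<delta> / 2" for p q
  proof -
    obtain n where n: "n \<ge> 1" "dist ((f ^^ (a * n)) p) p < \<delta> / 2"
      using rec[OF \<open>p \<in> X\<close>, of "\<delta> / 2"] \<open>\<delta> > 0\<close> by auto
    have "dist ((f ^^ (a * n)) p) q \<le> \<delta>"
      using dist_triangle[of "(f ^^ (a * n)) p" q p] n(2) that(2) by linarith
    then show ?thesis
      using near_return_imp_links[OF fX \<open>p \<in> X\<close>, of "a * n" a] n(1) a \<open>\<delta> > 0\<close> by simp
  qed
  have nbhd: "\<exists>T. openin (top_of_set C) T \<and> c \<in> T \<and> (\<forall>p\<in>T. \<forall>q\<in>T. links X f \<delta> a p q)"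
    if "c \<in> C" for c
  proof (intro exI[of _ "C \<inter> ball c (\<delta> / 4)"] conjI ballI)
    show "openin (top_of_set C) (C \<inter> ball c (\<delta> / 4))"
      by (simp add: openin_open_Int)
    show "c \<in> C \<inter> ball c (\<delta> / 4)"
      using that \<open>\<delta> > 0\<close> by simp
    fix p q assume "p \<in> C \<inter> ball c (\<delta> / 4)" "q \<in> C \<inter> ball c (\<delta> / 4)"
    then show "links X f \<delta> a p q"
      using near[of p q] C(2) dist_triangle[of p q c] by (auto simp: dist_commute)
  qed
  show ?thesis
  proof (rule connected_equivalence_relation_gen[OF C(1) uv, where P = "\<lambda>_. True"])
    show "links X f \<delta> a p r" if "links X f \<delta> a p q" "links X f \<delta> a q r" for p q r
      using that by (rule links_trans)
  qed (use nbhd in auto)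
qed

section \<open>Shadowable points\<close>

text \<open>If \<open>x\<close> almost returns to itself after \<open>a\<close> steps, every forward pseudo-orbit from \<open>x\<close> extends to a
  bi-infinite one, so that only nonnegative times need to be considered in the construction below.\<close>

lemma shadowable_point_forward:
  assumes fX: "f ` X \<subseteq> X" and a: "a \<ge> 1" and \<delta>: "\<delta> \<ge> 0" and x: "x \<in> X"
    and ret: "dist ((f ^^ a) x) x \<le> \<delta>"
    and \<eta>: "forward_pseudo_orbit X f \<delta> \<eta>" "\<eta> 0 = x"
    and sh: "\<And>\<xi>. \<lbrakk>pseudo_orbit X f \<delta> \<xi>; \<xi> 0 = x\<rbrakk> \<Longrightarrow> can_be_shadowed X f \<epsilon> \<xi>"
  shows "\<exists>w\<in>X. \<forall>n. dist ((f ^^ n) w) (\<eta> n) \<le> \<epsilon>"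
proof -
  (* The past repeats the almost closed orbit segment x, ..., f^(a-1) x, in phase with time 0. *)
  define \<xi> where "\<xi> n = (if n < 0 then (f ^^ nat (n mod int a)) x else \<eta> (nat n))" for n :: int
  have "dist (f (\<xi> n)) (\<xi> (n + 1)) \<le> \<delta>" for n
  proof (cases "n \<ge> 0")
    case True
    then show ?thesis
      using \<eta>(1) by (simp add: \<xi>_def forward_pseudo_orbit_def nat_add_distrib)
  next
    case False
    have step: "f (\<xi> n) = (f ^^ Suc (nat (n mod int a))) x"
      using False by (simp add: \<xi>_def)
    have succ: "\<xi> (n + 1) = (f ^^ nat ((n + 1) mod int a)) x"
      using False \<eta>(2) by (cases "n = -1") (auto simp: \<xi>_def)
    have r: "0 \<le> n mod int a" "n mod int a < int a"
      using a by auto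
    show ?thesis
    proof (cases "n mod int a + 1 = int a")
      case True
      then have "(n + 1) mod int a = 0"
        by (metis mod_add_left_eq mod_self)
      moreover have "Suc (nat (n mod int a)) = a"
        using True r by linarith
      ultimately show ?thesis
        using ret unfolding step succ by simp
    next
      case False
      then have "(n + 1) mod int a = n mod int a + 1"
        using r mod_pos_pos_trivial[of "n mod int a + 1" "int a"] mod_add_left_eq[of n "int a" 1]
        by linarith
      then show ?thesis
        using r \<delta> unfolding step succ by (simp add: nat_add_distrib)
    qed
  qed
  then have "pseudo_orbit X f \<delta> \<xi>"
    using \<eta>(1) funpow_in[OF fX x] by (simp add: pseudo_orbit_def \<xi>_def forward_pseudo_orbit_def)
  then have "can_be_shadowed X f \<epsilon> \<xi>"
    using sh \<eta>(2) by (simp add: \<xi>_def)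
  then obtain w where w: "w \<in> X" "\<And>n. dist (iter X f n w) (\<xi> n) \<le> \<epsilon>"
    unfolding can_be_shadowed_def by blast
  have "dist ((f ^^ n) w) (\<eta> n) \<le> \<epsilon>" for n
    using w(2)[of "int n"] by (simp add: iter_def \<xi>_def)
  then show ?thesis
    using w(1) by blast
qed

text \<open>A second point \<open>y\<close> in the component of \<open>x\<close> would give a point \<open>z\<close> near \<open>y\<close> whose iterates under
  \<open>f\<^sup>a\<close> eventually stay near \<open>x\<close>, against recurrence. It is essential that the excursion from \<open>x\<close>
  reaches \<open>y\<close> and comes back at multiples of \<open>a\<close>: the final periodic part is then in phase with
  the visit to \<open>y\<close>.\<close>

lemma distal_shadowable_imp_totally_disconnected_at:
  fixes X :: "'a::metric_space set"
  assumes "compact X" and cont: "continuous_on X f" and fX: "f ` X \<subseteq> X"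
    and "distal X f" and sh: "shadowable_point X f x"
  shows "totally_disconnected_at X x"
proof (rule ccontr)
  have x: "x \<in> X"
    using sh by (simp add: shadowable_point_def)
  have rec: "\<exists>n\<ge>1. dist ((f ^^ (a * n)) p) p < e" if "p \<in> X" "e > 0" for a p e
    using forward_distal_imp_recurrent_power[OF \<open>compact X\<close> cont fX
        distal_imp_forward_distal[OF \<open>distal X f\<close>] that] .
  let ?C = "connected_component_set X x"
  assume "\<not> totally_disconnected_at X x"
  moreover have xC: "x \<in> ?C"
    using x by (simp add: connected_component_refl)
  ultimately obtain y where yC: "y \<in> ?C" and "y \<noteq> x"
    unfolding totally_disconnected_at_def by blast
  define \<epsilon> where "\<epsilon> = dist x y / 4"
  have \<epsilon>: "\<epsilon> > 0"
    using \<open>y \<noteq> x\<close> by (simp add: \<epsilon>_def)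
  obtain \<delta> where \<delta>: "\<delta> > 0"
    and shad: "\<And>\<xi>. \<lbrakk>pseudo_orbit X f \<delta> \<xi>; \<xi> 0 = x\<rbrakk> \<Longrightarrow> can_be_shadowed X f \<epsilon> \<xi>"
    using sh \<epsilon> unfolding shadowable_point_def by blast
  obtain a where a: "a \<ge> 1" "dist ((f ^^ a) x) x < \<delta>"
    using rec[OF x \<delta>, of 1] by auto
  have link: "links X f \<delta> a p q" if "p \<in> ?C" "q \<in> ?C" for p q
    using connected_imp_links[OF fX \<delta> a(1) rec connected_connected_component
        connected_component_subset that] .
  (* The pseudo-orbit goes x -> y -> x and then repeats the almost closed segment of x. *)
  define per where "per n = (f ^^ (n mod a)) x" for n
  have "dist (f (per n)) (per (Suc n)) \<le> \<delta>" for n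
  proof -
    have "f (per n) = (f ^^ Suc (n mod a)) x"
      by (simp add: per_def)
    then show ?thesis
      using a \<delta> by (cases "Suc (n mod a) = a") (simp_all add: per_def mod_Suc)
  qed
  then have per: "forward_pseudo_orbit X f \<delta> per" "per 0 = x"
    using funpow_in[OF fX x] by (auto simp: forward_pseudo_orbit_def per_def)
  obtain s \<eta>\<^sub>1 where s: "a dvd s" and \<eta>\<^sub>1: "forward_pseudo_orbit X f \<delta> \<eta>\<^sub>1" "\<eta>\<^sub>1 0 = y"
      "\<And>i. \<eta>\<^sub>1 (s + i) = per i"
    using link[OF yC xC] per unfolding links_def by blast
  obtain t \<eta> where \<eta>: "forward_pseudo_orbit X f \<delta> \<eta>" "\<eta> 0 = x"
      "\<And>i. \<eta> (t + i) = \<eta>\<^sub>1 i"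
    using link[OF xC yC] \<eta>\<^sub>1(1,2) unfolding links_def by blast
  obtain w where w: "w \<in> X" "\<And>n. dist ((f ^^ n) w) (\<eta> n) \<le> \<epsilon>"
    using shadowable_point_forward[OF fX a(1) _ x _ \<eta>(1,2) shad] a(2) \<delta> by (meson less_imp_le)
  define z where "z = (f ^^ t) w"
  have zy: "dist z y \<le> \<epsilon>"
    using w(2)[of t] \<eta>(3)[of 0] \<eta>\<^sub>1(2) by (simp add: z_def)
  (* The factor Suc s makes the return time at least s, so that it falls in the periodic part. *)
  obtain n where n: "n \<ge> 1" "dist ((f ^^ (a * Suc s * n)) z) z < \<epsilon>"
    using rec[of z \<epsilon> "a * Suc s"] funpow_in[OF fX w(1)] \<epsilon> by (auto simp: z_def)
  define r where "r = a * Suc s * n"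
  have "Suc s \<le> r"
    using a(1) n(1) by (simp add: r_def del: mult_Suc_right)
  then obtain i where i: "r = s + i"
    by (metis Suc_leD le_Suc_ex)
  have "a dvd r"
    by (simp add: r_def del: mult_Suc_right)
  then have "a dvd i"
    using s unfolding i by (simp add: dvd_add_right_iff)
  then have "\<eta> (t + r) = x"
    using \<eta>(3) \<eta>\<^sub>1(3) by (simp add: i per_def)
  moreover have "(f ^^ r) z = (f ^^ (t + r)) w"
    by (metis z_def add.commute comp_apply funpow_add)
  ultimately have "dist ((f ^^ r) z) x \<le> \<epsilon>"
    using w(2)[of "t + r"] by simp
  then have "dist x y \<le> 3 * \<epsilon>"
    using zy n(2) dist_triangle3[of x y "(f ^^ r) z"] dist_triangle[of "(f ^^ r) z" y z]
    unfolding r_def by linarith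
  then show False
    using \<epsilon> unfolding \<epsilon>_def by linarith
qed

theorem corollary1p8:
  fixes X :: "'a::metric_space set"
  assumes "compact X"
    and "\<exists>f. self_homeomorphism X f \<and> distal X f \<and> almost_POTP X f"
  shows "almost_totally_disconnected X"
proof -
  obtain f where f: "self_homeomorphism X f" "distal X f" "almost_POTP X f"
    using assms(2) by blast
  have "continuous_on X f" "f ` X \<subseteq> X"
    using f(1) by (auto simp: self_homeomorphism_def homeomorphism_def)
  then have "Sh X f \<subseteq> deg X"
    using distal_shadowable_imp_totally_disconnected_at[OF assms(1) _ _ f(2)]
    by (auto simp: Sh_def deg_def shadowable_point_def)
  then show ?thesis
    using f(3) closure_mono unfolding almost_totally_disconnected_def almost_POTP_def by blast
qed

end
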